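(* Let $T$ be a plane labelled bipartite tree with $n$ white and $m$ black vertices, where $n+m$ is even. Let $T^*$ be obtained from $T$ by an elementary movement. Then $T^*$ and $T$ have opposite parities, i.e. $i(T^* )\ne i(T)$.
   Context: A plane labelled bipartite tree with $n$ white and $m$ black vertices is defined as follows. It is a finite tree embedded in the oriented plane, considered up to orientation-preserving homeomorphism. Its vertices are colored white and black so that adjacent vertices have different colors. The white vertices carry the distinct labels $v_1,\dots,v_n$ and the black vertices the distinct labels $u_1,\dots,u_m$. String $c(T)$: choose a white vertex $v_i$ (root vertex) and an edge $e$ incident to it (root edge). Walk counterclockwise around $T$ (contour walk keeping the tree on the left), starting at $v_i$ along $e$, until returning to $v_i$ after traversing every edge twice. Write a vertex's label when it is met for the first time, and a closing bracket ")" when it is met for the last time. Invariant: let - $a$ be the number of pairs of white labels with $v_k$ before $v_l$ in $c(T)$ and $k>l$; - $b$ be the analogous number of inversions among black labels; - $c$ be the number of pairs (black label, white label) with the black label before the white one; - $d$ be the number of pairs (closing bracket, label) with the bracket before the label; - $e_0=|n-m|/2$. Then $i(T)\equiv a+b+c+\tfrac{d+e_0}{2}\pmod 2$, with $i(T)\in\{0,1\}$. This value does not depend on the choice of root vertex and root edge. $T$ is even if $i(T)=0$ and odd otherwise. Movements: a leaf is a vertex $A$ of degree one together with its incident edge. Let $A$ be a leaf of $T$ attached to the vertex $B$ (of the opposite color to $A$). Remove $A$ and its edge, obtaining a plane tree $T'$; the former position of the edge determines a corner (angle between consecutive edges) of $T'$ at $B$. A movement moves $A$ along the contour of $T'$,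 clockwise or counterclockwise, and reattaches it (with its label) at a corner of some vertex $C$ of the same color as $B$; possibly $C=B$. The movement bypasses the vertices at the corners of $A$'s color passed along the way, counted with multiplicity: a vertex passed at two different corners counts twice. An elementary movement is one in which the leaf bypasses exactly one vertex of its own color. Equivalently, the leaf is reattached at the nearest corner of a vertex of $B$'s color along the contour of $T'$, in one of the two directions. *)

theory Defs
  imports Main
begin

section \<open>Labelled bipartite plane trees\<close>

text \<open>Vertices are identified with their labels: white vertex v_i is W i, black vertex u_j is Bl j.
  The colour of a vertex is the constructor.\<close>
datatype vtx = W nat | Bl nat

fun is_white :: "vtx \<Rightarrow> bool" where
  "is_white (W _) = True"
| "is_white (Bl _) = False"

definition verts :: "nat \<Rightarrow> nat \<Rightarrow> vtx set" where
  "verts n m = W ` {1..n} \<union> Bl ` {1..m}"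

text \<open>A plane tree with labelled vertices is given (canonically, since all vertices carry distinct
  labels) by its edge set E, stored as a symmetric set of darts (ordered pairs), together with its
  rotation system: rot v is the cyclic successor of a neighbour of v in the counterclockwise order of
  the edges around v. Two embeddings are equivalent under orientation preserving homeomorphisms
  respecting labels iff they have the same rotation system. Values of rot v outside the
  neighbourhood of v are irrelevant.\<close>
type_synonym ptree = "(vtx \<times> vtx) set \<times> (vtx \<Rightarrow> vtx \<Rightarrow> vtx)"

definition nbrs :: "(vtx \<times> vtx) set \<Rightarrow> vtx \<Rightarrow> vtx set" where
  "nbrs E v = {w. (v, w) \<in> E}"

definition plane_bip_tree :: "nat \<Rightarrow> nat \<Rightarrow> ptree \<Rightarrow> bool" where
  "plane_bip_tree n m T \<longleftrightarrow>
     (let E = fst T; rot = snd T in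
        E \<subseteq> verts n m \<times> verts n m
      \<and> sym E
      \<and> (\<forall>(x, y) \<in> E. is_white x \<noteq> is_white y)
      \<and> (\<forall>x \<in> verts n m. \<forall>y \<in> verts n m. (x, y) \<in> E\<^sup>*)
      \<and> card E = 2 * (n + m - 1)
      \<and> (\<forall>v \<in> verts n m. bij_betw (rot v) (nbrs E v) (nbrs E v)
            \<and> (\<forall>x \<in> nbrs E v. \<forall>y \<in> nbrs E v. \<exists>k. (rot v ^^ k) x = y)))"

section \<open>The string c(T)\<close>

text \<open>Contour walk: after traversing the dart (u,v), the walk continues with the dart
  (v, rot v u).\<close>
definition next_dart :: "(vtx \<Rightarrow> vtx \<Rightarrow> vtx) \<Rightarrow> vtx \<times> vtx \<Rightarrow> vtx \<times> vtx" where
  "next_dart rot d = (snd d, rot (snd d) (fst d))"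

text \<open>Sequence of vertices met along the contour walk starting at root vertex v along the root
  edge (v,w); it has card E + 1 entries, the first and the last being v.\<close>
definition contour_verts :: "ptree \<Rightarrow> vtx \<Rightarrow> vtx \<Rightarrow> vtx list" where
  "contour_verts T v w =
     v # map (\<lambda>k. snd ((next_dart (snd T) ^^ k) (v, w))) [0..<card (fst T)]"

datatype token = Lab vtx | Cl

text \<open>A label is written when a vertex is met for the first time and a closing bracket when it is
  met for the last time (for a leaf: label, then bracket).\<close>
definition cstring :: "ptree \<Rightarrow> vtx \<Rightarrow> vtx \<Rightarrow> token list" where
  "cstring T v w =
     (let xs = contour_verts T v w in
        concat (map (\<lambda>k.
            (if (\<forall>j<k. xs ! j \<noteq> xs ! k) then [Lab (xs ! k)] else [])
          @ (if (\<forall>j. k < j \<and> j < length xs \<longrightarrow> xs ! j \<noteq> xs ! k) then [Cl] else []))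
          [0..<length xs]))"

definition count_pairs :: "(token \<Rightarrow> token \<Rightarrow> bool) \<Rightarrow> token list \<Rightarrow> nat" where
  "count_pairs P s = card {(p, q). p < q \<and> q < length s \<and> P (s ! p) (s ! q)}"

definition inv_a :: "token list \<Rightarrow> nat" where
  "inv_a = count_pairs (\<lambda>x y. \<exists>k l. x = Lab (W k) \<and> y = Lab (W l) \<and> k > l)"

definition inv_b :: "token list \<Rightarrow> nat" where
  "inv_b = count_pairs (\<lambda>x y. \<exists>k l. x = Lab (Bl k) \<and> y = Lab (Bl l) \<and> k > l)"

definition inv_c :: "token list \<Rightarrow> nat" where
  "inv_c = count_pairs (\<lambda>x y. \<exists>k l. x = Lab (Bl k) \<and> y = Lab (W l))"

definition inv_d :: "token list \<Rightarrow> nat" where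
  "inv_d = count_pairs (\<lambda>x y. x = Cl \<and> (\<exists>z. y = Lab z))"

text \<open>i(T) = a + b + c + (d + e0)/2 mod 2, with e0 = |n - m|/2.\<close>
definition parity_of :: "nat \<Rightarrow> nat \<Rightarrow> token list \<Rightarrow> nat" where
  "parity_of n m s =
     (inv_a s + inv_b s + inv_c s + (inv_d s + nat \<bar>int n - int m\<bar> div 2) div 2) mod 2"

text \<open>Value of the invariant computed from root vertex v (white) and root edge (v,w).\<close>
definition inv_i :: "nat \<Rightarrow> nat \<Rightarrow> ptree \<Rightarrow> vtx \<Rightarrow> vtx \<Rightarrow> nat" where
  "inv_i n m T v w = parity_of n m (cstring T v w)"

definition is_root :: "ptree \<Rightarrow> vtx \<Rightarrow> vtx \<Rightarrow> bool" where
  "is_root T v w \<longleftrightarrow> is_white v \<and> (v, w) \<in> fst T"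

section \<open>Elementary movements\<close>

text \<open>Deleting the leaf A attached to B.\<close>
definition del_rot :: "(vtx \<Rightarrow> vtx \<Rightarrow> vtx) \<Rightarrow> vtx \<Rightarrow> vtx \<Rightarrow> (vtx \<Rightarrow> vtx \<Rightarrow> vtx)" where
  "del_rot rot A B = (\<lambda>x y. if x = B \<and> rot B y = A then rot B A else rot x y)"

text \<open>The corners of a plane tree correspond to the darts: the dart (x,C) stands for the corner
  at C between the edges (C,x) and (C, rot C x), i.e. the corner passed by the contour walk right
  after traversing (x,C). Inserting the leaf A into that corner:\<close>
definition ins_rot :: "(vtx \<Rightarrow> vtx \<Rightarrow> vtx) \<Rightarrow> vtx \<Rightarrow> vtx \<Rightarrow> vtx \<Rightarrow> (vtx \<Rightarrow> vtx \<Rightarrow> vtx)" where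
  "ins_rot rot A x C = (\<lambda>y z.
      if y = C \<and> z = x then A
      else if y = C \<and> z = A then rot C x
      else if y = A then C
      else rot y z)"

text \<open>T* is obtained from T by an elementary movement of the leaf A attached to B: in T' = T - A
  the leaf sat in the corner (p,B) with rot B p = A; it is moved two corners forward or two
  corners backward along the contour of T' (thereby bypassing exactly one corner, which belongs to
  a vertex of the colour of A) and reattached there, at a vertex C of the colour of B.\<close>
definition elem_move :: "nat \<Rightarrow> nat \<Rightarrow> ptree \<Rightarrow> ptree \<Rightarrow> bool" where
  "elem_move n m T Ts \<longleftrightarrow>
     (\<exists>A B p x C.
        A \<in> verts n m \<and> nbrs (fst T) A = {B}
        \<and> (let E' = fst T - {(A, B), (B, A)}; rot' = del_rot (snd T) A B in
             (p, B) \<in> E' \<and> snd T B p = A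
           \<and> (x, C) \<in> E'
           \<and> ((next_dart rot' ^^ 2) (p, B) = (x, C) \<or> (next_dart rot' ^^ 2) (x, C) = (p, B))
           \<and> fst Ts = E' \<union> {(A, C), (C, A)}
           \<and> (\<forall>(y, z) \<in> fst Ts. snd Ts y z = ins_rot rot' A x C y z)))"

end

theory Submission
  imports Defs
begin

text \<open>Let \<open>phi\<close> be twice the number of inversions among all labels (white before black) plus the
  number \<open>d\<close> of bracket-label pairs, so that the invariant is
  \<open>(phi + e0) div 2 mod 2\<close>. In a tree with \<open>N\<close> vertices, moving the root
  one dart along the contour changes \<open>phi\<close> by \<open>- N\<close> modulo 4; for even \<open>N\<close>, two steps
  change nothing, which gives independence of the white root. If the leaf \<open>A\<close> is attached in a
  corner of \<open>T'\<close> and the tree is rooted at that corner, then \<open>phi\<close> is its value for \<open>T'\<close>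
  rooted there plus a constant depending only on \<open>A\<close> and the labels of \<open>T'\<close>. Since \<open>T'\<close> has
  \<open>N - 1\<close> vertices, an odd number, moving the leaf by two corners changes \<open>phi\<close> by
  \<open>- 2 (N - 1)\<close>, which is 2 modulo 4.\<close>

section \<open>Counting pairs in token strings\<close>

lemma count_pairs_Nil [simp]: "count_pairs P [] = 0"
  by (simp add: count_pairs_def)

lemma count_pairs_Cons [simp]:
  "count_pairs P (x # s) = length (filter (P x) s) + count_pairs P s"
proof -
  let ?A = "{q. q < length s \<and> P x (s ! q)}"
  let ?B = "{(p, q). p < q \<and> q < length s \<and> P (s ! p) (s ! q)}"
  have eq: "{(p, q). p < q \<and> q < length (x # s) \<and> P ((x # s) ! p) ((x # s) ! q)}
      = (\<lambda>q. (0, Suc q)) ` ?A \<union> (\<lambda>(p, q). (Suc p, Suc q)) ` ?B" (is "?L = ?R")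
  proof
    show "?L \<subseteq> ?R"
    proof
      fix z assume "z \<in> ?L"
      then obtain p q where z: "z = (p, q)" "p < q" "q < length (x # s)"
        "P ((x # s) ! p) ((x # s) ! q)" by auto
      then obtain q' where q: "q = Suc q'" by (cases q) auto
      show "z \<in> ?R"
        using z q by (cases p) (auto simp: image_iff)
    qed
  qed auto
  have fin: "finite ?A" by simp
  have "?B \<subseteq> {..<length s} \<times> {..<length s}" by auto
  then have finB: "finite ?B" by (rule finite_subset) simp
  have "count_pairs P (x # s) = card ((\<lambda>q. (0::nat, Suc q)) ` ?A)
      + card ((\<lambda>(p, q). (Suc p, Suc q)) ` ?B)"
    unfolding count_pairs_def eq using fin finB by (intro card_Un_disjoint) auto
  also have "card ((\<lambda>q. (0::nat, Suc q)) ` ?A) = card ?A"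
    by (rule card_image) (auto simp: inj_on_def)
  also have "card ((\<lambda>(p, q). (Suc p, Suc q)) ` ?B) = card ?B"
    by (rule card_image) (auto simp: inj_on_def)
  finally show ?thesis
    by (simp add: length_filter_conv_card count_pairs_def)
qed

definition cross_pairs :: "(token \<Rightarrow> token \<Rightarrow> bool) \<Rightarrow> token list \<Rightarrow> token list \<Rightarrow> nat" where
  "cross_pairs P s t = (\<Sum>x\<leftarrow>s. length (filter (P x) t))"

lemma count_pairs_append:
  "count_pairs P (s @ t) = count_pairs P s + count_pairs P t + cross_pairs P s t"
  by (induction s) (auto simp: cross_pairs_def)

lemma cross_pairs_Nil_right [simp]: "cross_pairs P s [] = 0"
  by (induction s) (auto simp: cross_pairs_def)

lemma cross_pairs_Cons_right:
  "cross_pairs P s (y # t) = length (filter (\<lambda>x. P x y) s) + cross_pairs P s t"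
  by (induction s) (auto simp: cross_pairs_def)

lemma cross_pairs_append_right:
  "cross_pairs P s (t @ u) = cross_pairs P s t + cross_pairs P s u"
  by (induction s) (auto simp: cross_pairs_def)

section \<open>Inversions of all labels under one linear order\<close>

fun vless :: "vtx \<Rightarrow> vtx \<Rightarrow> bool" where
  "vless (W k) (W l) \<longleftrightarrow> k < l"
| "vless (W k) (Bl l) \<longleftrightarrow> True"
| "vless (Bl k) (W l) \<longleftrightarrow> False"
| "vless (Bl k) (Bl l) \<longleftrightarrow> k < l"

lemma vless_total: "u \<noteq> v \<Longrightarrow> vless u v \<longleftrightarrow> \<not> vless v u"
  by (cases u; cases v) auto

fun label_inv :: "token \<Rightarrow> token \<Rightarrow> bool" where
  "label_inv (Lab u) (Lab v) \<longleftrightarrow> vless v u"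
| "label_inv _ _ \<longleftrightarrow> False"

fun cl_lab :: "token \<Rightarrow> token \<Rightarrow> bool" where
  "cl_lab Cl (Lab v) \<longleftrightarrow> True"
| "cl_lab _ _ \<longleftrightarrow> False"

lemma label_inv_Cl [simp]: "label_inv Cl y \<longleftrightarrow> False" "label_inv x Cl \<longleftrightarrow> False"
  by (cases y; simp) (cases x; simp)

lemma cl_lab_simps [simp]: "cl_lab (Lab u) y \<longleftrightarrow> False" "cl_lab x Cl \<longleftrightarrow> False"
  by (cases y; simp) (cases x; simp)

text \<open>In \<open>vless\<close> every white label precedes every black one, so a black label
  before a white one is itself an inversion. The three patterns are mutually exclusive and exhaust
  \<open>label_inv\<close>.\<close>

lemma inv_abc_eq: "inv_a s + inv_b s + inv_c s = count_pairs label_inv s"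
proof (induction s)
  case Nil
  then show ?case by (simp add: inv_a_def inv_b_def inv_c_def)
next
  case (Cons x s)
  have "length (filter (\<lambda>y. \<exists>k l. x = Lab (W k) \<and> y = Lab (W l) \<and> k > l) s)
     + length (filter (\<lambda>y. \<exists>k l. x = Lab (Bl k) \<and> y = Lab (Bl l) \<and> k > l) s)
     + length (filter (\<lambda>y. \<exists>k l. x = Lab (Bl k) \<and> y = Lab (W l)) s)
     = length (filter (label_inv x) s)"
  proof (induction s)
    case (Cons y s)
    have "(\<exists>k l. x = Lab (W k) \<and> y = Lab (W l) \<and> k > l) \<or>
       (\<exists>k l. x = Lab (Bl k) \<and> y = Lab (Bl l) \<and> k > l) \<or>
       (\<exists>k l. x = Lab (Bl k) \<and> y = Lab (W l)) \<longleftrightarrow> label_inv x y"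
      by (cases x; cases y; cases "case x of Lab u \<Rightarrow> u"; cases "case y of Lab u \<Rightarrow> u") auto
    then show ?case using Cons by auto
  qed simp
  with Cons show ?case by (simp add: inv_a_def inv_b_def inv_c_def)
qed

lemma inv_d_eq: "inv_d s = count_pairs cl_lab s"
proof -
  have "(\<lambda>x y. x = Cl \<and> (\<exists>z. y = Lab z)) = cl_lab"
  proof (intro ext)
    fix x y show "(x = Cl \<and> (\<exists>z. y = Lab z)) = cl_lab x y" by (cases x; cases y) auto
  qed
  then show ?thesis by (simp add: inv_d_def)
qed

definition phi :: "token list \<Rightarrow> nat" where
  "phi s = 2 * count_pairs label_inv s + count_pairs cl_lab s"

lemma parity_of_phi:
  "parity_of n m s = (phi s + nat \<bar>int n - int m\<bar> div 2) div 2 mod 2"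
proof -
  have "(2 * a + d + e) div 2 = a + (d + e) div 2" for a d e :: nat by simp
  then show ?thesis by (simp add: parity_of_def phi_def inv_abc_eq inv_d_eq)
qed

text \<open>Adding twice an odd number before integer halving shifts the quotient by that odd
  number, whatever remainder is discarded.\<close>

lemma half_parity_differs:
  fixes a b e :: nat
  assumes "4 dvd int a - int b + 2"
  shows "(a + e) div 2 mod 2 \<noteq> (b + e) div 2 mod 2"
proof -
  obtain k where "int a - int b + 2 = 4 * k" using assms by (rule dvdE)
  then have k: "int a = int b + 2 * (2 * k - 1)" by simp
  have "int ((a + e) div 2) = (2 * (2 * k - 1) + (int b + int e)) div 2"
    by (simp add: k zdiv_int add.commute add.left_commute)
  also have "\<dots> = 2 * k - 1 + int ((b + e) div 2)"
    by (simp only: div_mult_self4 zdiv_int of_nat_add) (simp add: zdiv_int)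
  finally have "even ((a + e) div 2) \<noteq> even ((b + e) div 2)"
    by presburger
  then show ?thesis by (metis even_iff_mod_2_eq_zero)
qed

section \<open>Change of \<open>phi\<close> under rerooting and under insertion of a leaf\<close>

definition nlab :: "token list \<Rightarrow> nat" where
  "nlab s = length (filter (\<lambda>x. x \<noteq> Cl) s)"

definition ncl :: "token list \<Rightarrow> nat" where
  "ncl s = length (filter (\<lambda>x. x = Cl) s)"

lemma nlab_simps [simp]: "nlab [] = 0" "nlab (Lab v # s) = Suc (nlab s)" "nlab (Cl # s) = nlab s"
  "nlab (s @ t) = nlab s + nlab t"
  by (auto simp: nlab_def)

lemma ncl_simps [simp]: "ncl [] = 0" "ncl (Lab v # s) = ncl s" "ncl (Cl # s) = Suc (ncl s)"
  "ncl (s @ t) = ncl s + ncl t"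
  by (auto simp: ncl_def)

lemma filter_cl_lab [simp]:
  "length (filter (cl_lab Cl) s) = nlab s" "length (filter (\<lambda>x. cl_lab x (Lab v)) s) = ncl s"
proof -
  have "cl_lab Cl = (\<lambda>y. y \<noteq> Cl)"
  proof
    show "cl_lab Cl y = (y \<noteq> Cl)" for y by (cases y) auto
  qed
  then show "length (filter (cl_lab Cl) s) = nlab s" by (simp add: nlab_def)
  have "cl_lab y (Lab v) \<longleftrightarrow> y = Cl" for y by (cases y) auto
  then show "length (filter (\<lambda>x. cl_lab x (Lab v)) s) = ncl s" by (simp add: ncl_def)
qed

text \<open>Every label of \<open>s\<close> is either below or above \<open>v\<close>, so it forms
  an inversion with \<open>v\<close> in exactly one of the two orders.\<close>

lemma filter_label_inv_swap:
  assumes "Lab v \<notin> set s"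
  shows "length (filter (label_inv (Lab v)) s) + length (filter (\<lambda>x. label_inv x (Lab v)) s) = nlab s"
  using assms
proof (induction s)
  case (Cons x s)
  then show ?case by (cases x) (use vless_total in auto)
qed simp

text \<open>Here \<open>s @ [Cl]\<close> stands for the string of the first child's subtree.
  Rerooting moves \<open>Lab v\<close> behind \<open>s\<close> and the bracket of the child to the
  end. With \<open>i\<close> inversions between \<open>v\<close> and \<open>s\<close> before and
  \<open>nlab s - i\<close> after, the unknown \<open>i\<close> enters \<open>phi\<close> as
  \<open>4 * i\<close> and vanishes modulo 4. Brackets of \<open>s\<close> gain the label
  \<open>v\<close>; the moved bracket loses the labels of \<open>r\<close>.\<close>

lemma phi_reroot:
  assumes "Lab v \<notin> set s"
  shows "4 dvd int (phi (s @ Lab v # r @ [Cl])) - int (phi (Lab v # s @ Cl # r))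
    - 2 * int (nlab s) - int (ncl s) + int (nlab r)"
proof -
  let ?i = "length (filter (label_inv (Lab v)) s)"
  have "int (phi (s @ Lab v # r @ [Cl])) - int (phi (Lab v # s @ Cl # r))
    = 2 * (int (nlab s) - 2 * int ?i) + int (ncl s) - int (nlab r)"
    using filter_label_inv_swap[OF assms]
    by (simp add: phi_def count_pairs_append cross_pairs_append_right cross_pairs_Cons_right)
  then show ?thesis by simp
qed

text \<open>The leaf \<open>v\<close> becomes the first child of the root \<open>u\<close>. Of
  \<open>u\<close> and \<open>v\<close> exactly one is smaller; trading the inversion of
  \<open>u\<close> before \<open>v\<close> for its complement costs the constant 2 and a multiple of
  4. What remains counts all labels below \<open>v\<close>, the root's included, and so does not see
  which vertex is the root.\<close>

lemma phi_insert_leaf: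
  assumes "u \<noteq> v"
  shows "4 dvd int (phi (Lab u # Lab v # Cl # r)) - int (phi (Lab u # r)) - int (nlab r)
    - 2 - 2 * int (length (filter (label_inv (Lab v)) (Lab u # r)))"
  using vless_total[OF assms] by (simp add: phi_def)

section \<open>Contour words of ordered trees\<close>

text \<open>A nontrivial rooted plane tree is split into the subtree of the first child of the root and
  the rest, which keeps the root; this makes moving the root along the first edge a local
  operation.\<close>
datatype otree = Single vtx | Join otree otree

fun root :: "otree \<Rightarrow> vtx" where
  "root (Single v) = v"
| "root (Join S R) = root R"

fun walk :: "otree \<Rightarrow> vtx list" where
  "walk (Single v) = [v]"
| "walk (Join S R) = root R # walk S @ walk R"

fun toks :: "otree \<Rightarrow> token list" where
  "toks (Single v) = [Lab v, Cl]"
| "toks (Join S R) = Lab (root R) # toks S @ tl (toks R)"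

fun distinct_tree :: "otree \<Rightarrow> bool" where
  "distinct_tree (Single v) = True"
| "distinct_tree (Join S R) \<longleftrightarrow>
     distinct_tree S \<and> distinct_tree R \<and> set (walk S) \<inter> set (walk R) = {}"

text \<open>The tree \<open>Join S R\<close> with its root moved across the first edge: the old root
  with the remainder \<open>R\<close> becomes the last child of \<open>root S\<close>.\<close>

fun attach_last :: "otree \<Rightarrow> otree \<Rightarrow> otree" where
  "attach_last (Single w) R = Join R (Single w)"
| "attach_last (Join S1 R1) R = Join S1 (attach_last R1 R)"

lemma walk_Cons: "\<exists>xs. walk t = root t # xs"
  by (cases t) auto

lemma root_in_walk [simp]: "root t \<in> set (walk t)"
  using walk_Cons[of t] by auto

lemma hd_walk [simp]: "hd (walk t) = root t"
  using walk_Cons[of t] by auto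

lemma walk_nonempty [simp]: "walk t \<noteq> []"
  by (cases t) auto

lemma toks_shape: "\<exists>xs. toks t = Lab (root t) # xs @ [Cl]"
proof (induction t)
  case (Join S R)
  then show ?case by auto
qed simp

lemma root_attach_last [simp]: "root (attach_last S R) = root S"
  by (induction S) auto

text \<open>Compared with \<open>walk (Join S R)\<close>, the first vertex is dropped and
  \<open>root S\<close> is appended: the contour is shifted by one dart.\<close>

lemma walk_attach_last: "walk (attach_last S R) = walk S @ walk R @ [root S]"
  by (induction S) auto

lemma distinct_attach_last:
  "distinct_tree S \<Longrightarrow> distinct_tree R \<Longrightarrow> set (walk S) \<inter> set (walk R) = {}
    \<Longrightarrow> distinct_tree (attach_last S R)"
proof (induction S)
  case (Single x)
  then show ?case by auto
next
  case (Join S1 R1)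
  then show ?case using root_in_walk[of R1] by (auto simp: walk_attach_last)
qed

lemma toks_attach_last: "toks (attach_last S R) = butlast (toks S) @ toks R @ [Cl]"
proof (induction S)
  case (Join S1 R1)
  obtain xs where "toks R1 = Lab (root R1) # xs @ [Cl]" using toks_shape by blast
  then show ?case using Join by (simp add: butlast_append)
qed simp

lemma nlab_toks: "nlab (toks t) = ncl (toks t) \<and> length (walk t) + 1 = 2 * nlab (toks t)"
proof (induction t)
  case (Join S R)
  obtain xs where "toks R = Lab (root R) # xs @ [Cl]" using toks_shape by blast
  then show ?case using Join by simp
qed simp

lemma Lab_in_toks: "Lab v \<in> set (toks t) \<Longrightarrow> v \<in> set (walk t)"
proof (induction t)
  case (Join S R)
  then show ?case by (cases "toks R") auto
qed simp

text \<open>Distinctness lets each label occur once. The right-hand side involves only the vertex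
  set, hence is the same for every choice of root.\<close>

lemma filter_toks:
  assumes "distinct_tree t"
  shows "length (filter (label_inv (Lab v)) (toks t)) = card {u \<in> set (walk t). vless u v}"
  using assms
proof (induction t)
  case (Single x)
  have "{u. u = x \<and> vless u v} = (if vless x v then {x} else {})" by auto
  then show ?case by simp
next
  case (Join S R)
  obtain xs where xs: "toks R = Lab (root R) # xs @ [Cl]" using toks_shape by blast
  have "{u \<in> set (walk (Join S R)). vless u v}
     = {u \<in> set (walk S). vless u v} \<union> {u \<in> set (walk R). vless u v}" by auto
  then have "card {u \<in> set (walk (Join S R)). vless u v}
     = card {u \<in> set (walk S). vless u v} + card {u \<in> set (walk R). vless u v}"
    using Join.prems by (auto intro: card_Un_disjoint)
  then show ?case using Join xs by auto
qed

text \<open>If \<open>S\<close> has k of the N vertices, then \<open>phi_reroot\<close> applies with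
  k labels and k - 1 brackets in \<open>s\<close> and N - 1 - k labels in \<open>r\<close>. The
  change is 2k + (k - 1) - (N - 1 - k) = 4k - N.\<close>

lemma phi_attach_last:
  assumes "distinct_tree (Join S R)"
  shows "4 dvd int (phi (toks (attach_last S R))) - int (phi (toks (Join S R)))
    + int (nlab (toks (Join S R)))"
proof -
  obtain r where r: "toks R = Lab (root R) # r" using toks_shape by blast
  obtain s where s: "toks S = s @ [Cl]"
    using toks_shape[of S] by (metis append_Cons)
  have "Lab (root R) \<notin> set s"
  proof
    assume "Lab (root R) \<in> set s"
    then have "root R \<in> set (walk S)" by (intro Lab_in_toks) (simp add: s)
    with assms show False using root_in_walk[of R] by auto
  qed
  note 1 = phi_reroot[OF this, of r]
  have 2: "nlab s = ncl s + 1" using nlab_toks[of S] s by simp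
  have 3: "toks (attach_last S R) = s @ Lab (root R) # r @ [Cl]"
    "toks (Join S R) = Lab (root R) # s @ Cl # r"
    by (simp_all add: toks_attach_last s r)
  show ?thesis using 1 unfolding 3 using 2 by simp presburger
qed

text \<open>The tokens written along a stretch of the contour, where the vertices in \<open>A\<close> were met before
  it and those in \<open>B\<close> are met after it.\<close>
fun tokens_between :: "vtx set \<Rightarrow> vtx set \<Rightarrow> vtx list \<Rightarrow> token list" where
  "tokens_between A B [] = []"
| "tokens_between A B (x # xs) = (if x \<notin> A then [Lab x] else []) @
     (if x \<notin> B \<and> x \<notin> set xs then [Cl] else []) @ tokens_between (insert x A) B xs"

lemma tokens_between_append:
  "tokens_between A B (xs @ ys) =
     tokens_between A (B \<union> set ys) xs @ tokens_between (A \<union> set xs) B ys"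
  by (induction xs arbitrary: A) auto

lemma tokens_between_cong:
  "A \<inter> set xs = A' \<inter> set xs \<Longrightarrow> B \<inter> set xs = B' \<inter> set xs
    \<Longrightarrow> tokens_between A B xs = tokens_between A' B' xs"
proof (induction xs arbitrary: A A')
  case (Cons x xs)
  have "tokens_between (insert x A) B xs = tokens_between (insert x A') B' xs"
    using Cons.prems by (intro Cons.IH) auto
  moreover have "x \<in> A \<longleftrightarrow> x \<in> A'" "x \<in> B \<longleftrightarrow> x \<in> B'" using Cons.prems by auto
  ultimately show ?case by simp
qed simp

text \<open>Brings the recursion to the indexed form used in \<open>cstring\<close>, which is the
  case of empty \<open>A\<close> and \<open>B\<close>.\<close>

lemma tokens_between_conv:
  "tokens_between A B xs = concat (map (\<lambda>k.
      (if xs ! k \<notin> A \<and> (\<forall>j<k. xs ! j \<noteq> xs ! k) then [Lab (xs ! k)] else [])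
    @ (if xs ! k \<notin> B \<and> (\<forall>j. k < j \<and> j < length xs \<longrightarrow> xs ! j \<noteq> xs ! k) then [Cl] else []))
    [0..<length xs])"
proof (induction xs arbitrary: A)
  case (Cons x xs)
  have ball: "(\<forall>j<Suc k. P j) \<longleftrightarrow> P 0 \<and> (\<forall>j<k. P (Suc j))" for P k
    using less_Suc_eq_0_disj by auto
  have ball': "(\<forall>j. Suc k < j \<and> j < Suc l \<longrightarrow> P j) \<longleftrightarrow> (\<forall>j. k < j \<and> j < l \<longrightarrow> P (Suc j))" for P k l
    by (metis Suc_less_eq Suc_less_eq2)
  have ball0: "(\<forall>j. 0 < j \<and> j < Suc (length xs) \<longrightarrow> (x # xs) ! j \<noteq> x) \<longleftrightarrow> x \<notin> set xs"
    by (auto simp: in_set_conv_nth gr0_conv_Suc)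
  have upt: "[0..<length (x # xs)] = 0 # map Suc [0..<length xs]"
    by (simp add: map_Suc_upt upt_conv_Cons del: upt_Suc)
  show ?case
    unfolding upt tokens_between.simps
    using ball0
    by (simp add: ball ball' Cons comp_def del: upt_Suc)
      (intro conjI impI arg_cong[of _ _ concat] map_cong refl; auto)
qed simp

lemma tokens_between_walk:
  "distinct_tree t \<Longrightarrow> tokens_between {} {} (walk t) = toks t"
proof (induction t)
  case (Join S R)
  let ?v = "root R"
  obtain xs where xs: "walk R = ?v # xs" using walk_Cons by blast
  have dis: "set (walk S) \<inter> set (walk R) = {}" using Join.prems by simp
  have "?v \<notin> set (walk S)" using dis root_in_walk[of R] by blast
  then have "tokens_between {?v} (set (walk R)) (walk S) = toks S"
    using dis Join by (subst tokens_between_cong[where A' = "{}" and B' = "{}"]) auto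
  \<comment> \<open>On the return to the root its label has already been written, which accounts for
    the \<open>tl\<close> in \<open>toks\<close>.\<close>
  moreover have "tokens_between ({?v} \<union> set (walk S)) {} (walk R) = tokens_between {?v} {} (walk R)"
    using dis by (intro tokens_between_cong) auto
  moreover have "tokens_between {?v} {} (walk R) = tl (toks R)"
    using Join by (simp add: xs flip: Join.IH(2))
  ultimately show ?case
    using root_in_walk[of R] by (simp add: tokens_between_append)
qed simp

lemma cstring_eq_toks:
  assumes "distinct_tree t" "walk t = contour_verts T v w"
  shows "cstring T v w = toks t"
  using tokens_between_walk[OF assms(1)]
  unfolding cstring_def tokens_between_conv assms(2) by (simp add: Let_def)

section \<open>Contour walks in rotation systems\<close>

text \<open>All darts form a single cycle of \<open>next_dart\<close>, listed by \<open>ds\<close>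
  from the root dart; \<open>t\<close> is the ordered tree with the same contour. The equation with
  \<open>rotate1\<close> says that each entry is followed by its successor, the last one by the
  first.\<close>

definition unicursal :: "ptree \<Rightarrow> (vtx \<times> vtx) list \<Rightarrow> otree \<Rightarrow> bool" where
  "unicursal T ds t \<longleftrightarrow> distinct ds \<and> set ds = fst T \<and> ds \<noteq> []
     \<and> map (next_dart (snd T)) ds = rotate1 ds
     \<and> distinct_tree t \<and> walk t = fst (hd ds) # map snd ds"

lemma nth_eq_funpow_hd:
  assumes "map f ds = rotate1 ds" "k < length ds"
  shows "ds ! k = (f ^^ k) (hd ds)"
  using assms(2)
proof (induction k)
  case 0
  then show ?case by (simp add: hd_conv_nth)
next
  case (Suc k)
  have "f (ds ! k) = rotate1 ds ! k" using Suc.prems assms(1) by (metis Suc_lessD nth_map)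
  also have "\<dots> = ds ! Suc k" using Suc.prems by (simp add: nth_rotate1)
  finally show ?case using Suc by simp
qed

lemma unicursal_cstring:
  assumes "unicursal T ds t" "hd ds = (v, w)"
  shows "cstring T v w = toks t"
proof (rule cstring_eq_toks)
  show "distinct_tree t" using assms(1) by (simp add: unicursal_def)
  have cyc: "map (next_dart (snd T)) ds = rotate1 ds" using assms(1) by (simp add: unicursal_def)
  have card: "card (fst T) = length ds"
    using assms(1) by (auto simp: unicursal_def distinct_card dest: sym)
  have "map (\<lambda>k. snd ((next_dart (snd T) ^^ k) (v, w))) [0..<length ds] = map snd ds"
    using nth_eq_funpow_hd[OF cyc] assms(2) by (intro nth_equalityI) auto
  then show "walk t = contour_verts T v w"
    using assms by (simp add: unicursal_def contour_verts_def card)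
qed

lemma unicursal_rotate1:
  assumes "unicursal T ds t"
  obtains S R where "t = Join S R" "unicursal T (rotate1 ds) (attach_last S R)"
    "hd (rotate1 ds) = next_dart (snd T) (hd ds)"
proof (cases t)
  case (Single x)
  \<comment> \<open>A one-vertex walk has no darts, against \<open>ds\<close> being
    nonempty.\<close>
  then show ?thesis using assms by (auto simp: unicursal_def)
next
  case (Join S R)
  obtain d ds' where ds: "ds = d # ds'" using assms by (cases ds) (auto simp: unicursal_def)
  have cyc: "map (next_dart (snd T)) ds = rotate1 ds" using assms by (simp add: unicursal_def)
  have hd: "hd (rotate1 ds) = next_dart (snd T) (hd ds)" unfolding cyc[symmetric] by (simp add: ds)
  have w: "walk S @ walk R = snd d # map snd ds'" using assms Join ds by (simp add: unicursal_def)
  then have "root S = snd d" by (metis hd_append2 hd_walk list.sel(1) walk_nonempty)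
  then have "walk (attach_last S R) = fst (hd (rotate1 ds)) # map snd (rotate1 ds)"
    unfolding hd walk_attach_last append_assoc[symmetric] w by (simp add: ds next_dart_def)
  moreover have "map (next_dart (snd T)) (rotate1 ds) = rotate1 (rotate1 ds)"
    by (metis cyc rotate1_map)
  ultimately have "unicursal T (rotate1 ds) (attach_last S R)"
    using assms Join by (auto simp: unicursal_def distinct_attach_last)
  then show ?thesis using that Join hd by blast
qed

lemma unicursal_funpow:
  assumes "unicursal T ds t"
  shows "\<exists>ds' t'. unicursal T ds' t' \<and> hd ds' = (next_dart (snd T) ^^ k) (hd ds)"
proof (induction k)
  case 0
  then show ?case using assms by auto
next
  case (Suc k)
  then show ?case by (metis unicursal_rotate1 funpow.simps(2) comp_apply)
qed

lemma unicursal_orbit: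
  assumes "unicursal T ds t" "d \<in> fst T"
  shows "\<exists>k. (next_dart (snd T) ^^ k) (hd ds) = d"
proof -
  obtain k where "k < length ds" "ds ! k = d"
    using assms unfolding unicursal_def by (metis in_set_conv_nth)
  then show ?thesis using nth_eq_funpow_hd assms(1) unfolding unicursal_def by metis
qed

lemma unicursal_at:
  assumes "unicursal T ds t" "d \<in> fst T"
  obtains ds' t' where "unicursal T ds' t'" "hd ds' = d"
  using unicursal_funpow[OF assms(1)] unicursal_orbit[OF assms] by metis

lemma unicursal_nlab:
  assumes "unicursal T ds t"
  shows "2 * nlab (toks t) = card (fst T) + 2"
proof -
  have "card (fst T) = length ds"
    using assms by (auto simp: unicursal_def distinct_card dest: sym)
  moreover have "length (walk t) = length ds + 1" using assms by (simp add: unicursal_def)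
  ultimately show ?thesis using nlab_toks[of t] by simp
qed

lemma next_dart_in:
  assumes "unicursal T ds t" "d \<in> fst T"
  shows "next_dart (snd T) d \<in> fst T"
proof -
  have "next_dart (snd T) d \<in> set (map (next_dart (snd T)) ds)"
    using assms unfolding unicursal_def set_map by blast
  also have "\<dots> = fst T" using assms(1) by (simp add: unicursal_def)
  finally show ?thesis .
qed

lemma funpow_next_dart_in:
  assumes "unicursal T ds t" "d \<in> fst T"
  shows "(next_dart (snd T) ^^ k) d \<in> fst T"
  using assms next_dart_in[OF assms(1)] by (induction k) auto

section \<open>\<open>phi\<close> modulo 4 as a function of the root dart\<close>

definition dart_phi :: "ptree \<Rightarrow> vtx \<times> vtx \<Rightarrow> nat" where
  "dart_phi T d = phi (cstring T (fst d) (snd d))"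

text \<open>Moving the root along an edge that cuts off \<open>s\<close> of the \<open>N\<close> vertices changes the label
  inversions by \<open>s\<close> modulo 2 and the bracket-label pairs by \<open>2 s - N\<close>; hence the
  change of \<open>dart_phi\<close> does not depend on \<open>s\<close> modulo 4.\<close>
lemma dart_phi_next:
  assumes "unicursal T ds t" "d \<in> fst T" "2 * N = card (fst T) + 2"
  shows "4 dvd int (dart_phi T (next_dart (snd T) d)) - int (dart_phi T d) + int N"
proof -
  obtain ds' t' where u: "unicursal T ds' t'" "hd ds' = d" using unicursal_at[OF assms(1,2)] .
  obtain S R where SR: "t' = Join S R" "unicursal T (rotate1 ds') (attach_last S R)"
    "hd (rotate1 ds') = next_dart (snd T) (hd ds')"
    using unicursal_rotate1[OF u(1)] .
  have "cstring T (fst d) (snd d) = toks t'" using unicursal_cstring[OF u(1)] u(2) by simp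
  moreover have "cstring T (fst (next_dart (snd T) d)) (snd (next_dart (snd T) d)) = toks (attach_last S R)"
    using unicursal_cstring[OF SR(2)] SR(3) u(2) by simp
  moreover have "nlab (toks t') = N" using unicursal_nlab[OF u(1)] assms(3) by simp
  moreover have "distinct_tree (Join S R)" using u(1) SR(1) by (simp add: unicursal_def)
  ultimately show ?thesis using phi_attach_last[of S R] SR(1) by (simp add: dart_phi_def)
qed

lemma dart_phi_funpow:
  assumes "unicursal T ds t" "d \<in> fst T" "2 * N = card (fst T) + 2"
  shows "4 dvd int (dart_phi T ((next_dart (snd T) ^^ k) d)) - int (dart_phi T d) + int k * int N"
proof (induction k)
  case (Suc k)
  have "4 dvd int (dart_phi T (next_dart (snd T) ((next_dart (snd T) ^^ k) d)))
      - int (dart_phi T ((next_dart (snd T) ^^ k) d)) + int N"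
    by (rule dart_phi_next[OF assms(1) funpow_next_dart_in[OF assms(1,2)] assms(3)])
  from dvd_add[OF this Suc] show ?case by (simp add: algebra_simps)
qed simp

text \<open>Rooted at the corner that receives the leaf, the contour of \<open>T\<close> is the
  excursion to \<open>A\<close> and back followed by the whole contour of \<open>T'\<close> from
  that corner. The correction to \<open>phi\<close> depends on \<open>A\<close> and
  \<open>T'\<close> only, not on the corner, so it cancels when two insertions are compared.\<close>

lemma unicursal_insert_leaf:
  assumes u: "unicursal T' ds t" and x: "(x, C) \<in> fst T'" and "sym (fst T')"
    and A: "A \<notin> snd ` fst T'"
    and E: "fst T = fst T' \<union> {(A, C), (C, A)}"
    and rot: "\<forall>(y, z) \<in> fst T. snd T y z = ins_rot (snd T') A x C y z"
  shows "\<exists>ds t. unicursal T ds t"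
    and "4 dvd int (dart_phi T (C, A)) - int (dart_phi T' (next_dart (snd T') (x, C)))
      - int (card (fst T') div 2) - 2 - 2 * int (card {u \<in> snd ` fst T'. vless u A})"
proof -
  obtain ds1 t1 where u1: "unicursal T' ds1 t1" "hd ds1 = (x, C)" using unicursal_at[OF u x] .
  obtain ds0 where ds1: "ds1 = (x, C) # ds0"
    using u1 by (cases ds1) (auto simp: unicursal_def)
  \<comment> \<open>Rotating once makes the list start with the dart leaving the corner and end with
    \<open>(x, C)\<close>.\<close>
  obtain S1 R1 where "unicursal T' (rotate1 ds1) (attach_last S1 R1)"
    and hd2: "hd (rotate1 ds1) = next_dart (snd T') (x, C)"
    using unicursal_rotate1[OF u1(1)] u1(2) by metis
  then obtain t2 where u2: "unicursal T' (rotate1 ds1) t2" by blast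
  let ?r = "rotate1 ds1"
  let ?d = "next_dart (snd T') (x, C)"
  have rds: "?r = ds0 @ [(x, C)]" by (simp add: ds1)
  have root: "root t2 = C"
    using u2 hd2 by (metis hd_walk list.sel(1) unicursal_def next_dart_def fst_conv snd_conv)
  have setr: "set ?r = fst T'" "distinct ?r" using u2 by (auto simp: unicursal_def)
  have A': "A \<notin> fst ` fst T'" using A \<open>sym (fst T')\<close> by (force simp: sym_def)
  have AC: "A \<noteq> C" using A x by force
  have walk2: "walk t2 = C # map snd ?r"
    using u2 root walk_Cons[of t2] by (auto simp: unicursal_def)
  have set_walk: "set (walk t2) = snd ` fst T'"
    unfolding walk2 setr(1)[symmetric] using x setr(1) by force
  define t' where "t' = Join (Single A) t2"
  define ds' where "ds' = (C, A) # (A, C) # ?r"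
  \<comment> \<open>Rotations change only at \<open>A\<close> and in the one corner at
    \<open>C\<close>, so every old dart except \<open>(x, C)\<close> keeps its successor.\<close>
  have nx: "next_dart (snd T) (y, z) = next_dart (snd T') (y, z)" if "(y, z) \<in> set ds0" for y z
  proof -
    have in': "(y, z) \<in> fst T'" using that setr rds by auto
    then have "(z, y) \<in> fst T'" using symD[OF \<open>sym (fst T')\<close>] by blast
    then have "snd T z y = ins_rot (snd T') A x C z y" using rot E by blast
    moreover have "(y, z) \<noteq> (x, C)" using that setr rds by auto
    moreover have "y \<noteq> A" "z \<noteq> A" using in' A A' by force+
    ultimately show ?thesis by (auto simp: next_dart_def ins_rot_def)
  qed
  have xA: "x \<noteq> A" using x A' by force
  have Cx: "(C, x) \<in> fst T'" using symD[OF \<open>sym (fst T')\<close> x] .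
  have r1: "snd T C x = A" "snd T C A = snd T' C x" "snd T A C = C"
    using bspec[OF rot, of "(C, x)"] bspec[OF rot, of "(C, A)"] bspec[OF rot, of "(A, C)"] E Cx AC xA
    by (simp_all add: ins_rot_def)
  have "map (next_dart (snd T')) ds1 = rotate1 ds1" using u1(1) by (simp add: unicursal_def)
  then have m: "?d # map (next_dart (snd T')) ds0 = ?r" by (simp add: ds1)
  have "map (next_dart (snd T)) ds0 = map (next_dart (snd T')) ds0"
    using nx by (intro map_cong) auto
  then have "?d # map (next_dart (snd T)) ds0 = ?r" by (simp only: m)
  then have cyc: "map (next_dart (snd T)) ds' = rotate1 ds'"
    using r1 unfolding ds'_def rds by (simp add: next_dart_def)
  have "set ds' = fst T" using E setr by (auto simp: ds'_def)
  moreover have "distinct ds'" using setr A A' AC unfolding ds'_def by force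
  moreover have dt: "distinct_tree t2" using u2 by (simp add: unicursal_def)
  then have "distinct_tree t'" using A set_walk by (simp add: t'_def)
  moreover have "walk t' = fst (hd ds') # map snd ds'"
    using root by (simp add: t'_def ds'_def walk2)
  ultimately have uT: "unicursal T ds' t'" using cyc by (simp add: unicursal_def ds'_def)
  then show "\<exists>ds t. unicursal T ds t" by blast
  have c1: "cstring T C A = toks t'" using unicursal_cstring[OF uT] by (simp add: ds'_def)
  have c2: "cstring T' (fst ?d) (snd ?d) = toks t2" using unicursal_cstring[OF u2] hd2 by simp
  obtain r where r: "toks t2 = Lab C # r" using toks_shape[of t2] root by auto
  have "nlab r = card (fst T') div 2" using unicursal_nlab[OF u2] r by simp
  moreover have "length (filter (label_inv (Lab A)) (Lab C # r)) = card {u \<in> snd ` fst T'. vless u A}"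
    using filter_toks[OF dt, of A] by (simp add: r set_walk)
  ultimately show "4 dvd int (dart_phi T (C, A)) - int (dart_phi T' ?d)
      - int (card (fst T') div 2) - 2 - 2 * int (card {u \<in> snd ` fst T'. vless u A})"
    using phi_insert_leaf[of C A r] AC
    by (simp add: dart_phi_def c1 c2 t'_def root r del: filter.simps)
qed

section \<open>Leaf deletion\<close>

text \<open>Plane trees on an arbitrary finite vertex set: deleting a leaf leaves a gap among the
  labels, so the induction needs a class without the fixed set \<open>verts n m\<close>.\<close>

definition plane_tree :: "vtx set \<Rightarrow> ptree \<Rightarrow> bool" where
  "plane_tree V T \<longleftrightarrow> finite V \<and> fst T \<subseteq> V \<times> V \<and> sym (fst T) \<and> irrefl (fst T)
     \<and> (\<forall>x \<in> V. \<forall>y \<in> V. (x, y) \<in> (fst T)\<^sup>*)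
     \<and> card (fst T) = 2 * (card V - 1)
     \<and> (\<forall>v \<in> V. bij_betw (snd T v) (nbrs (fst T) v) (nbrs (fst T) v)
          \<and> (\<forall>x \<in> nbrs (fst T) v. \<forall>y \<in> nbrs (fst T) v. \<exists>k. (snd T v ^^ k) x = y))"

section \<open>Existence, removal and reinsertion of leaves\<close>

lemma plane_tree_nbrs_nonempty:
  assumes "plane_tree V T" "2 \<le> card V" "v \<in> V"
  shows "nbrs (fst T) v \<noteq> {}"
proof -
  have "\<not> V \<subseteq> {v}" using assms(2) card_mono[of "{v}" V] by auto
  then obtain y where "y \<in> V" "y \<noteq> v" by auto
  then have "(v, y) \<in> (fst T)\<^sup>*" using assms by (auto simp: plane_tree_def)
  with \<open>y \<noteq> v\<close> show ?thesis by (auto simp: nbrs_def elim: converse_rtranclE)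
qed

text \<open>The degrees sum to 2(N - 1) < 2N, so some vertex has degree below 2; connectedness rules
  out degree 0.\<close>

lemma plane_tree_exists_leaf:
  assumes T: "plane_tree V T" and V: "2 \<le> card V"
  obtains A B where "A \<in> V" "nbrs (fst T) A = {B}"
proof -
  have fin: "finite V" "fst T \<subseteq> V \<times> V" using T by (auto simp: plane_tree_def)
  have nb: "finite (nbrs (fst T) v)" for v
    using fin by (auto simp: nbrs_def intro: finite_subset[of _ V])
  have "fst T = Sigma V (nbrs (fst T))" using fin by (auto simp: nbrs_def)
  then have "card (fst T) = (\<Sum>v\<in>V. card (nbrs (fst T) v))"
    using card_SigmaI[of V "nbrs (fst T)"] fin nb by simp
  then have sum: "(\<Sum>v\<in>V. card (nbrs (fst T) v)) < 2 * card V"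
    using T V by (auto simp: plane_tree_def)
  have "\<exists>v\<in>V. card (nbrs (fst T) v) < 2"
  proof (rule ccontr)
    assume "\<not> ?thesis"
    then have "(\<Sum>v\<in>V. 2) \<le> (\<Sum>v\<in>V. card (nbrs (fst T) v))" by (intro sum_mono) auto
    with sum show False by simp
  qed
  then obtain v where v: "v \<in> V" "card (nbrs (fst T) v) < 2" by blast
  moreover have "card (nbrs (fst T) v) \<noteq> 0"
    using plane_tree_nbrs_nonempty[OF T V v(1)] nb by simp
  ultimately have "card (nbrs (fst T) v) = 1" by linarith
  then obtain B where "nbrs (fst T) v = {B}" by (rule card_1_singletonE)
  then show ?thesis using that v(1) by blast
qed

text \<open>A fixed point of a transitive rotation would be the only neighbour.\<close>

lemma plane_tree_leaf_rot:
  assumes T: "plane_tree V T" and B: "B \<in> V" and AB: "A \<in> nbrs (fst T) B"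
    and p: "p \<in> nbrs (fst T) B" "p \<noteq> A"
  shows "snd T B A \<noteq> A"
proof
  assume fp: "snd T B A = A"
  obtain k where "(snd T B ^^ k) A = p" using T B AB p unfolding plane_tree_def by blast
  moreover have "(snd T B ^^ k) A = A" by (induction k) (auto simp: fp)
  ultimately show False using p by simp
qed

lemma plane_tree_delete_leaf:
  assumes T: "plane_tree V T" and A: "A \<in> V" "nbrs (fst T) A = {B}"
    and p: "p \<in> nbrs (fst T) B" "p \<noteq> A"
  shows "plane_tree (V - {A}) (fst T - {(A, B), (B, A)}, del_rot (snd T) A B)"
proof -
  let ?E = "fst T" and ?r = "snd T"
  let ?E' = "?E - {(A, B), (B, A)}" and ?r' = "del_rot ?r A B"
  have fin: "finite V" and sub: "?E \<subseteq> V \<times> V" and sym: "sym ?E" and irr: "irrefl ?E"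
    and card: "card ?E = 2 * (card V - 1)"
    and conn: "\<And>x y. x \<in> V \<Longrightarrow> y \<in> V \<Longrightarrow> (x, y) \<in> ?E\<^sup>*"
    and bij: "\<And>v. v \<in> V \<Longrightarrow> bij_betw (?r v) (nbrs ?E v) (nbrs ?E v)"
    and trans: "\<And>v x y. v \<in> V \<Longrightarrow> x \<in> nbrs ?E v \<Longrightarrow> y \<in> nbrs ?E v \<Longrightarrow> \<exists>k. (?r v ^^ k) x = y"
    using T by (auto simp: plane_tree_def)
  have AB: "(A, B) \<in> ?E" using A by (auto simp: nbrs_def)
  then have BA: "(B, A) \<in> ?E" using symD[OF sym] by blast
  have ne: "A \<noteq> B" using irr AB by (auto simp: irrefl_def)
  have B: "B \<in> V" using sub AB by auto
  have leaf: "y = B" if "(A, y) \<in> ?E" for y using A that by (auto simp: nbrs_def)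
  have leaf': "y = B" if "(y, A) \<in> ?E" for y using leaf symD[OF sym that] .
  have sub': "?E' \<subseteq> (V - {A}) \<times> (V - {A})" using sub leaf leaf' by auto
  have sym': "sym ?E'" using sym by (auto simp: sym_def)
  have finE: "finite ?E" using finite_subset[OF sub] fin by simp
  have card': "card ?E' = 2 * (card (V - {A}) - 1)"
  proof -
    have "card ?E' = card ?E - card {(A, B), (B, A)}"
      using AB BA by (intro card_Diff_subset) auto
    then show ?thesis using card ne A(1) by simp
  qed
  \<comment> \<open>A path can enter and leave \<open>A\<close> only through \<open>B\<close>; while
    it stands at \<open>A\<close>, the path in the smaller tree waits at \<open>B\<close>.\<close>
  have reach: "(if y = A then (x, B) \<in> ?E'\<^sup>* else (x, y) \<in> ?E'\<^sup>*)"
    if "(x, y) \<in> ?E\<^sup>*" "x \<noteq> A" for x y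
    using that
  proof (induction rule: rtrancl_induct)
    case (step y z)
    show ?case
    proof (cases "y = A \<or> z = A")
      case True
      then show ?thesis using step leaf leaf' ne by (metis (full_types))
    next
      case False
      then have "(y, z) \<in> ?E'" using step by auto
      moreover have "(x, y) \<in> ?E'\<^sup>*" using False step by simp
      ultimately show ?thesis using False by (simp add: rtrancl.rtrancl_into_rtrancl)
    qed
  qed simp
  have conn': "(x, y) \<in> ?E'\<^sup>*" if "x \<in> V - {A}" "y \<in> V - {A}" for x y
    using reach[OF conn, of x y] that by auto
  have inA: "A \<in> nbrs ?E B" using BA by (simp add: nbrs_def)
  have rA: "?r B A \<noteq> A" using plane_tree_leaf_rot[OF T B inA p] .
  have nB: "nbrs ?E' B = nbrs ?E B - {A}" using ne by (auto simp: nbrs_def)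
  have r'B: "?r' B y = (if ?r B y = A then ?r B A else ?r B y)" for y by (simp add: del_rot_def)
  have injB: "inj_on (?r B) (nbrs ?E B)" and imB: "?r B ` nbrs ?E B = nbrs ?E B"
    using bij[OF B] by (auto simp: bij_betw_def)
  have bijB: "bij_betw (?r' B) (nbrs ?E' B) (nbrs ?E' B)"
    unfolding bij_betw_def
  proof
    show "inj_on (?r' B) (nbrs ?E' B)"
      unfolding nB
    proof (rule inj_onI)
      fix y z assume "y \<in> nbrs ?E B - {A}" "z \<in> nbrs ?E B - {A}" "?r' B y = ?r' B z"
      then show "y = z"
        using inj_onD[OF injB, of y z] inj_onD[OF injB, of A z] inj_onD[OF injB, of y A] inA
        by (auto simp: r'B split: if_splits)
    qed
    have "nbrs ?E B - {A} \<subseteq> ?r' B ` (nbrs ?E B - {A})"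
    proof
      fix z assume z: "z \<in> nbrs ?E B - {A}"
      then obtain y where y: "y \<in> nbrs ?E B" "z = ?r B y" using imB by blast
      show "z \<in> ?r' B ` (nbrs ?E B - {A})"
      proof (cases "y = A")
        case True
        \<comment> \<open>The successor of \<open>A\<close> now has the predecessor of
          \<open>A\<close> as its preimage.\<close>
        obtain q where q: "q \<in> nbrs ?E B" "?r B q = A" using imB inA by (metis imageE)
        then have "z = ?r' B q" using True y by (simp add: r'B)
        moreover have "q \<noteq> A" using q rA by auto
        ultimately show ?thesis using q by blast
      next
        case False
        then show ?thesis using y z by (intro image_eqI[of _ _ y]) (auto simp: r'B)
      qed
    qed
    moreover have "?r' B ` (nbrs ?E B - {A}) \<subseteq> nbrs ?E B - {A}"
      using imB rA inA by (auto simp: r'B)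
    ultimately show "?r' B ` nbrs ?E' B = nbrs ?E' B" unfolding nB by blast
  qed
  \<comment> \<open>The new rotation follows the old one but skips \<open>A\<close>: a visit to
    \<open>A\<close> is replaced by its successor, so one new step may cover two old ones.\<close>
  have orbit: "\<exists>j. (?r' B ^^ j) x = (if (?r B ^^ k) x = A then ?r B A else (?r B ^^ k) x)"
    if "x \<noteq> A" for x k
  proof (induction k)
    case 0
    show ?case using that by (intro exI[of _ 0]) simp
  next
    case (Suc k)
    then obtain j where j: "(?r' B ^^ j) x = (if (?r B ^^ k) x = A then ?r B A else (?r B ^^ k) x)" ..
    show ?case
    proof (cases "(?r B ^^ k) x = A")
      case True
      then show ?thesis using j rA by (intro exI[of _ j]) simp
    next
      case False
      then have "(?r' B ^^ Suc j) x = ?r' B ((?r B ^^ k) x)" using j by simp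
      then show ?thesis unfolding r'B by (intro exI[of _ "Suc j"]) simp
    qed
  qed
  have transB: "\<exists>k. (?r' B ^^ k) x = y" if "x \<in> nbrs ?E' B" "y \<in> nbrs ?E' B" for x y
  proof -
    have xy: "x \<in> nbrs ?E B" "x \<noteq> A" "y \<in> nbrs ?E B" "y \<noteq> A" using that nB by auto
    then obtain k where "(?r B ^^ k) x = y" using trans[OF B] by blast
    then show ?thesis using orbit[of x k] xy by auto
  qed
  have other: "?r' v = ?r v" "nbrs ?E' v = nbrs ?E v" if "v \<in> V - {A}" "v \<noteq> B" for v
    using that by (auto simp: del_rot_def nbrs_def)
  have "bij_betw (?r' v) (nbrs ?E' v) (nbrs ?E' v)
      \<and> (\<forall>x \<in> nbrs ?E' v. \<forall>y \<in> nbrs ?E' v. \<exists>k. (?r' v ^^ k) x = y)" if "v \<in> V - {A}" for v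
  proof (cases "v = B")
    case True
    then show ?thesis using bijB transB by simp
  next
    case False
    then show ?thesis using other[OF that] bij trans that by simp
  qed
  then show ?thesis
    using fin sub' sym' irr card' conn' by (auto simp: plane_tree_def irrefl_def)
qed

text \<open>By injectivity of the rotation, \<open>p\<close> is the only predecessor of
  \<open>A\<close> at \<open>B\<close>, hence reinserting \<open>A\<close> after \<open>p\<close>
  undoes the deletion. Thus every tree with a leaf is an instance of leaf insertion.\<close>

lemma plane_tree_eq_insert_leaf:
  assumes T: "plane_tree V T" and A: "nbrs (fst T) A = {B}"
    and p: "p \<in> nbrs (fst T) B" "p \<noteq> A" "snd T B p = A"
  shows "\<forall>(y, z) \<in> fst T. snd T y z = ins_rot (del_rot (snd T) A B) A p B y z"
proof -
  have sub: "fst T \<subseteq> V \<times> V" and sym: "sym (fst T)" and irr: "irrefl (fst T)"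
    using T by (auto simp: plane_tree_def)
  have AB: "(A, B) \<in> fst T" using A by (auto simp: nbrs_def)
  have V: "A \<in> V" "B \<in> V" using AB sub by auto
  have "bij_betw (snd T A) {B} {B}" using T V A by (force simp: plane_tree_def)
  then have rA: "snd T A B = B" by (simp add: bij_betw_def)
  have inj: "inj_on (snd T B) (nbrs (fst T) B)" using T V by (auto simp: plane_tree_def bij_betw_def)
  show ?thesis
  proof (clarify)
    fix y z assume yz: "(y, z) \<in> fst T"
    have ne: "A \<noteq> B" using irr AB by (auto simp: irrefl_def)
    show "snd T y z = ins_rot (del_rot (snd T) A B) A p B y z"
    proof (cases "y = A")
      case True
      then have "z = B" using yz A by (auto simp: nbrs_def)
      with True show ?thesis using rA ne by (simp add: ins_rot_def)
    next
      case False
      have "z = p" if "y = B" "snd T B z = A"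
        using inj_onD[OF inj, of z p] yz that p by (simp add: nbrs_def)
      then consider "y \<noteq> B" | "y = B" "z = p" | "y = B" "z \<noteq> p" "snd T B z \<noteq> A" by blast
      then show ?thesis
        using False p(2,3) by cases (simp_all add: ins_rot_def del_rot_def)
    qed
  qed
qed

text \<open>Induction by removing a leaf: its two darts are spliced into the single cycle of the
  smaller tree. The base case is a single edge.\<close>

lemma plane_tree_unicursal:
  assumes "plane_tree V T" "2 \<le> card V"
  shows "\<exists>ds t. unicursal T ds t"
  using assms
proof (induction "card V" arbitrary: V T)
  case (Suc k)
  note T = Suc.prems(1)
  have fin: "finite V" and sub: "fst T \<subseteq> V \<times> V" and sym: "sym (fst T)" and irr: "irrefl (fst T)"
    using T by (auto simp: plane_tree_def)
  obtain A B where A: "A \<in> V" "nbrs (fst T) A = {B}"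
    using plane_tree_exists_leaf[OF Suc.prems] .
  have AB: "(A, B) \<in> fst T" "(B, A) \<in> fst T" using A symD[OF sym, of A B] by (auto simp: nbrs_def)
  have B: "B \<in> V" "A \<noteq> B" using AB sub irr by (auto simp: irrefl_def)
  show ?case
  proof (cases "nbrs (fst T) B = {A}")
    case True
    \<comment> \<open>Two leaves adjacent to each other form a whole component, hence the whole
      tree.\<close>
    have "y \<in> {A, B}" if "(A, y) \<in> (fst T)\<^sup>*" for y
      using that by (induction rule: rtrancl_induct) (use A True in \<open>auto simp: nbrs_def\<close>)
    then have "V \<subseteq> {A, B}" using T A(1) unfolding plane_tree_def by blast
    then have E: "fst T = {(A, B), (B, A)}" using sub AB irr by (auto simp: irrefl_def)
    have "bij_betw (snd T A) {B} {B}" "bij_betw (snd T B) {A} {A}"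
      using T A B True by (force simp: plane_tree_def)+
    then have "snd T A B = B" "snd T B A = A" by (simp_all add: bij_betw_def)
    then have "unicursal T [(A, B), (B, A)] (Join (Single B) (Single A))"
      using E B by (auto simp: unicursal_def next_dart_def)
    then show ?thesis by blast
  next
    case False
    have inA: "A \<in> nbrs (fst T) B" using AB by (simp add: nbrs_def)
    then obtain q where q: "q \<in> nbrs (fst T) B" "q \<noteq> A" using False by blast
    have "snd T B ` nbrs (fst T) B = nbrs (fst T) B" using T B by (auto simp: plane_tree_def bij_betw_def)
    then obtain p where p: "p \<in> nbrs (fst T) B" "snd T B p = A" using inA by (metis imageE)
    have pA: "p \<noteq> A" using plane_tree_leaf_rot[OF T B(1) inA q] p by auto
    let ?T' = "(fst T - {(A, B), (B, A)}, del_rot (snd T) A B)"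
    have T': "plane_tree (V - {A}) ?T'" using plane_tree_delete_leaf[OF T A p(1) pA] .
    have pV: "p \<in> V" "p \<noteq> B" using p sub irr by (auto simp: nbrs_def irrefl_def)
    \<comment> \<open>Three distinct vertices ensure that the smaller tree still has at least
      two.\<close>
    have "{A, B, p} \<subseteq> V" using A B pV by auto
    then have "card {A, B, p} \<le> card V" using fin card_mono by blast
    then have "3 \<le> card V" using pA B pV by simp
    then have "\<exists>ds t. unicursal ?T' ds t"
      using Suc.hyps(2) fin A by (intro Suc.hyps(1)[OF _ T']) auto
    then obtain ds t where u: "unicursal ?T' ds t" by blast
    have pB: "(p, B) \<in> fst ?T'" using p pA B symD[OF sym, of B p] by (auto simp: nbrs_def)
    have T'_facts: "sym (fst ?T')" "A \<notin> snd ` fst ?T'" "fst T = fst ?T' \<union> {(A, B), (B, A)}"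
      using T' AB by (auto simp: plane_tree_def)
    show ?thesis
      using unicursal_insert_leaf(1)[OF u pB T'_facts]
        plane_tree_eq_insert_leaf[OF T A(2) p(1) pA p(2)] by simp
  qed
qed simp

lemma plane_bip_tree_plane_tree:
  assumes "plane_bip_tree n m T"
  shows "plane_tree (verts n m) T" "card (verts n m) = n + m"
proof -
  have "card (verts n m) = card (W ` {1..n}) + card (Bl ` {1..m})"
    unfolding verts_def by (intro card_Un_disjoint) auto
  also have "\<dots> = n + m" by (simp add: card_image inj_on_def)
  finally show c: "card (verts n m) = n + m" .
  show "plane_tree (verts n m) T"
    using assms unfolding plane_bip_tree_def plane_tree_def Let_def c
    by (auto simp: irrefl_def verts_def)
qed

section \<open>Parity of elementary movements\<close>

lemma is_white_funpow_next_dart: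
  assumes u: "unicursal T ds t" and bip: "\<forall>(x, y) \<in> fst T. is_white x \<noteq> is_white y"
    and d: "d \<in> fst T"
  shows "is_white (fst ((next_dart (snd T) ^^ k) d)) \<longleftrightarrow> (is_white (fst d) \<longleftrightarrow> even k)"
proof (induction k)
  case (Suc k)
  let ?e = "(next_dart (snd T) ^^ k) d"
  have "?e \<in> fst T" using funpow_next_dart_in[OF u d] .
  then have "is_white (fst ?e) \<noteq> is_white (snd ?e)" using bip by (cases ?e) auto
  moreover have "fst ((next_dart (snd T) ^^ Suc k) d) = snd ?e" by (simp add: next_dart_def[of _ ?e])
  ultimately show ?case using Suc by auto
qed simp

text \<open>Going from \<open>d\<close> to the white root takes k steps and changes
  \<open>phi\<close> by - k N. Since N is even, only the parity of k matters modulo 4, and colours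
  alternating along the contour tie it to the colour of \<open>fst d\<close>. A black
  \<open>d\<close> is allowed because the leaf may hang on a black vertex.\<close>

lemma dart_phi_white_root:
  assumes u: "unicursal T ds t" and bip: "\<forall>(x, y) \<in> fst T. is_white x \<noteq> is_white y"
    and d: "d \<in> fst T" and r: "is_root T v w" and N: "2 * N = card (fst T) + 2" "even N"
  shows "4 dvd int (dart_phi T (v, w)) - int (dart_phi T d) + (if is_white (fst d) then 0 else int N)"
proof -
  have vw: "(v, w) \<in> fst T" "is_white v" using r by (auto simp: is_root_def)
  obtain ds' t' where u': "unicursal T ds' t'" "hd ds' = d" using unicursal_at[OF u d] .
  obtain k where k: "(next_dart (snd T) ^^ k) d = (v, w)"
    using unicursal_orbit[OF u'(1) vw(1)] u'(2) by auto
  have "is_white (fst d) \<longleftrightarrow> even k" using is_white_funpow_next_dart[OF u bip d, of k] k vw(2) by simp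
  moreover have "4 dvd int (dart_phi T (v, w)) - int (dart_phi T d) + int k * int N"
    using dart_phi_funpow[OF u d N(1), of k] k by simp
  moreover obtain M where "N = 2 * M" using N(2) by blast
  moreover have "even k \<Longrightarrow> 4 dvd int k * int (2 * M)"
    by (auto elim!: evenE)
  moreover have "odd k \<Longrightarrow> 4 dvd int k * int (2 * M) - int (2 * M)"
    by (auto elim!: oddE simp: algebra_simps)
  ultimately show ?thesis by (auto; presburger)
qed

theorem mainTheorem4:
  fixes n m :: nat and T Ts :: ptree and v w v' w' :: vtx
  assumes "plane_bip_tree n m T"
    and "even (n + m)"
    and "elem_move n m T Ts"
    and "is_root T v w"
    and "is_root Ts v' w'"
  shows "inv_i n m Ts v' w' \<noteq> inv_i n m T v w"
proof -
  note T = plane_bip_tree_plane_tree[OF assms(1)]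
  have bip: "\<forall>(x, y) \<in> fst T. is_white x \<noteq> is_white y"
    using assms(1) by (auto simp: plane_bip_tree_def Let_def)
  obtain A B p x C where A: "A \<in> verts n m" "nbrs (fst T) A = {B}"
    and pB': "(p, B) \<in> fst T - {(A, B), (B, A)}" and p: "snd T B p = A"
    and xC': "(x, C) \<in> fst T - {(A, B), (B, A)}"
    and mv': "(next_dart (del_rot (snd T) A B) ^^ 2) (p, B) = (x, C)
      \<or> (next_dart (del_rot (snd T) A B) ^^ 2) (x, C) = (p, B)"
    and Ts': "fst Ts = fst T - {(A, B), (B, A)} \<union> {(A, C), (C, A)}"
    and rots': "\<forall>(y, z) \<in> fst Ts. snd Ts y z = ins_rot (del_rot (snd T) A B) A x C y z"
    using assms(3) unfolding elem_move_def Let_def by (elim exE conjE) (rule that)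
  define T' where "T' = (fst T - {(A, B), (B, A)}, del_rot (snd T) A B)"
  have pB: "(p, B) \<in> fst T'" and xC: "(x, C) \<in> fst T'"
    and Ts: "fst Ts = fst T' \<union> {(A, C), (C, A)}"
    and rots: "\<forall>(y, z) \<in> fst Ts. snd Ts y z = ins_rot (snd T') A x C y z"
    and mv: "(next_dart (snd T') ^^ 2) (p, B) = (x, C) \<or> (next_dart (snd T') ^^ 2) (x, C) = (p, B)"
    using pB' xC' Ts' rots' mv' by (simp_all add: T'_def)
  have sym: "sym (fst T)" and sub: "fst T \<subseteq> verts n m \<times> verts n m" and irr: "irrefl (fst T)"
    and cardT: "card (fst T) = 2 * (n + m - 1)" and fin: "finite (verts n m)"
    using T by (auto simp: plane_tree_def)
  have AB: "(A, B) \<in> fst T" "(B, A) \<in> fst T" using A symD[OF sym, of A B] by (auto simp: nbrs_def)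
  have pn: "p \<in> nbrs (fst T) B" "p \<noteq> A" using pB' symD[OF sym, of p B] by (auto simp: nbrs_def)
  have T': "plane_tree (verts n m - {A}) T'"
    unfolding T'_def by (rule plane_tree_delete_leaf[OF T(1) A pn])
  have cardV: "card (verts n m - {A}) = n + m - 1" using A fin T(2) by simp
  have cardT': "card (fst T') = 2 * (n + m - 1 - 1)" using T' by (simp add: plane_tree_def cardV)
  have sub': "fst T' \<subseteq> (verts n m - {A}) \<times> (verts n m - {A})" and sym': "sym (fst T')"
    and fin': "finite (fst T')"
    using T' fin by (auto simp: plane_tree_def intro: finite_subset)
  \<comment> \<open>The dart \<open>(p, B)\<close> survives the deletion, so at least three vertices
    were present.\<close>
  have "card (fst T') \<noteq> 0" using pB fin' by auto
  then have nm: "n + m \<ge> 3" using cardT' by linarith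
  obtain ds t where u': "unicursal T' ds t"
  proof -
    have "2 \<le> card (verts n m - {A})" using nm cardV by simp
    then show ?thesis using plane_tree_unicursal[OF T'] that by blast
  qed
  have A': "A \<notin> snd ` fst T'" "A \<notin> fst ` fst T'" using sub' by auto
  have TE: "fst T = fst T' \<union> {(A, B), (B, A)}" using AB by (auto simp: T'_def)
  \<comment> \<open>Both \<open>T\<close> and \<open>Ts\<close> are now insertions of
    \<open>A\<close> into the same tree \<open>T'\<close>, at the corners \<open>(p, B)\<close> and
    \<open>(x, C)\<close>.\<close>
  have rotT: "\<forall>(y, z) \<in> fst T. snd T y z = ins_rot (snd T') A p B y z"
    using plane_tree_eq_insert_leaf[OF T(1) A(2) pn p] by (simp add: T'_def)
  note insT = unicursal_insert_leaf[OF u' pB sym' A'(1) TE rotT]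
  note insTs = unicursal_insert_leaf[OF u' xC sym' A'(1) Ts rots]
  obtain dT tT where uT: "unicursal T dT tT" using insT(1) by blast
  obtain dS tS where uS: "unicursal Ts dS tS" using insTs(1) by blast
  have bip': "\<forall>(x, y) \<in> fst T'. is_white x \<noteq> is_white y" using bip by (auto simp: T'_def)
  \<comment> \<open>Two contour steps preserve colour. Hence \<open>B\<close> and \<open>C\<close>
    agree in colour, \<open>Ts\<close> is bipartite, and the root correction \<open>?w\<close> is
    common to both trees.\<close>
  have "is_white p \<longleftrightarrow> is_white x"
    using mv is_white_funpow_next_dart[OF u' bip' pB, of 2] is_white_funpow_next_dart[OF u' bip' xC, of 2]
    by auto
  then have BC: "is_white B \<longleftrightarrow> is_white C" using bip' pB xC by blast
  have "is_white A \<noteq> is_white B" using bip AB by blast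
  then have bipS: "\<forall>(x, y) \<in> fst Ts. is_white x \<noteq> is_white y" using bip' BC Ts by auto
  have AC: "(A, C) \<notin> fst T'" "(C, A) \<notin> fst T'" "A \<noteq> C" using A' xC by force+
  have cardS: "card (fst Ts) = 2 * (n + m - 1)"
    using Ts AC fin' cardT' nm by simp
  have N: "2 * (n + m) = card (fst T) + 2" "2 * (n + m) = card (fst Ts) + 2"
    "2 * (n + m - 1) = card (fst T') + 2"
    using cardT cardS cardT' nm by auto
  let ?w = "if is_white B then 0 else int (n + m)"
  have 1: "4 dvd int (dart_phi T (v, w)) - int (dart_phi T (B, A)) + ?w"
    using dart_phi_white_root[OF uT bip _ assms(4) N(1) assms(2), of "(B, A)"] TE by simp
  have 2: "4 dvd int (dart_phi Ts (v', w')) - int (dart_phi Ts (C, A)) + ?w"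
    using dart_phi_white_root[OF uS bipS _ assms(5) N(2) assms(2), of "(C, A)"] Ts BC by simp
  let ?f = "\<lambda>d. int (dart_phi T' (next_dart (snd T') d))"
  have two: "4 dvd ?f ((next_dart (snd T') ^^ 2) d) - ?f d + 2" if "d \<in> fst T'" for d
  proof -
    have "4 dvd int (dart_phi T' ((next_dart (snd T') ^^ 2) (next_dart (snd T') d)))
        - ?f d + int 2 * int (n + m - 1)"
      by (rule dart_phi_funpow[OF u' next_dart_in[OF u' that] N(3)])
    \<comment> \<open>The number of vertices of \<open>T'\<close> is odd, so twice it is 2 modulo
      4.\<close>
    moreover have "4 dvd int 2 * int (n + m - 1) - 2"
      using assms(2) nm by presburger
    ultimately show ?thesis by (simp add: numeral_2_eq_2) presburger
  qed
  \<comment> \<open>Forward and backward movements agree because 2 and - 2 coincide modulo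
    4.\<close>
  have 3: "4 dvd ?f (x, C) - ?f (p, B) + 2"
    using mv
  proof
    assume "(next_dart (snd T') ^^ 2) (p, B) = (x, C)"
    then show ?thesis using two[OF pB] by simp
  next
    assume "(next_dart (snd T') ^^ 2) (x, C) = (p, B)"
    then have "4 dvd ?f (p, B) - ?f (x, C) + 2" using two[OF xC] by simp
    then show ?thesis by presburger
  qed
  \<comment> \<open>Subtracting cancels \<open>?w\<close> and the leaf corrections; only the shift
    of the corner in \<open>T'\<close> remains.\<close>
  have "4 dvd int (dart_phi Ts (v', w')) - int (dart_phi T (v, w)) + 2"
    using dvd_add[OF dvd_add[OF dvd_diff[OF 2 1] dvd_diff[OF insTs(2) insT(2)]] 3]
    by (simp add: algebra_simps)
  then show ?thesis
    unfolding inv_i_def parity_of_phi dart_phi_def fst_conv snd_conv by (rule half_parity_differs)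
qed

end
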